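(* Let $X$ be a compact Hausdorff space with compatible uniform structure $\mathscr{U}_X$ and let $f\colon X\to X$ be a continuous map such that $(f,X)$ is a minimal cascade. Then $$\inf_{x\in X}\mathrm{BD}_*(f,x,\varepsilon)>0\quad\text{for all }\varepsilon\in\mathscr{U}_X .$$
   Context: $(f,X)$ is a minimal cascade if for every $x\in X$ the forward orbit $\{f^n x : n=0,1,2,\dots\}$ is dense in $X$. $\mathscr{U}_X$ is the unique compatible symmetric uniform structure on the compact Hausdorff space $X$; for $\varepsilon\in\mathscr{U}_X$ and $x\in X$, $\varepsilon[x]=\{y\in X : (x,y)\in\varepsilon\}$, which is an open neighborhood of $x$ (entourages are taken symmetric and open). For $x,y\in X$, $N_f(x,\varepsilon[y])=\{n\in\mathbb{Z}_+ : f^n x\in\varepsilon[y]\}$, where $\mathbb{Z}_+=\{0,1,2,\dots\}$. With $|\cdot|$ the counting measure on $\mathbb{Z}_+$, the Banach lower density is $$\mathrm{BD}_*(f,x,\varepsilon)=\liminf_{N-M\to\infty}\frac{|[M,N)\cap N_f(x,\varepsilon[x])|}{N-M},$$ where $0\le M<N$ are integers and $\liminf_{N-M\to\infty}$ means $\lim_{L\to\infty}\inf\{\cdot : N-M\ge L\}$. *)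

theory Defs
  imports "HOL-Analysis.Analysis"
begin

text \<open>The space \<open>X\<close> is a type of class \<^class>\<open>uniform_space\<close>, whose \<^const>\<open>uniformity\<close> is by the class
  axioms compatible with the topology; on a compact Hausdorff space it is the only such uniformity.\<close>

definition minimal_cascade :: "('a::topological_space \<Rightarrow> 'a) \<Rightarrow> bool" where
  "minimal_cascade f \<longleftrightarrow> (\<forall>x. closure {(f ^^ n) x | n. True} = UNIV)"

text \<open>Convention: entourages are symmetric and open; these form a base of the uniformity.\<close>

definition entourages :: "('a::uniform_space \<times> 'a) set set" where
  "entourages = {E. (\<forall>\<^sub>F p in uniformity. p \<in> E) \<and> sym E \<and> open E}"

definition return_times :: "('a \<Rightarrow> 'a) \<Rightarrow> 'a \<Rightarrow> 'a set \<Rightarrow> nat set" where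
  "return_times f x U = {n. (f ^^ n) x \<in> U}"

definition window_inf :: "nat set \<Rightarrow> nat \<Rightarrow> real" where
  "window_inf A L =
     (INF (M, N) \<in> {(M, N). M < N \<and> N - M \<ge> L}. real (card ({M..<N} \<inter> A)) / real (N - M))"

definition banach_lower_density :: "nat set \<Rightarrow> real" where
  "banach_lower_density A = lim (window_inf A)"

text \<open>The section \<open>\<epsilon>[x] = {y. (x, y) \<in> \<epsilon>}\<close> is the relational image \<open>E `` {x}\<close>.\<close>

definition BD_lower :: "('a \<Rightarrow> 'a) \<Rightarrow> 'a \<Rightarrow> ('a \<times> 'a) set \<Rightarrow> real" where
  "BD_lower f x E = banach_lower_density (return_times f x (E `` {x}))"

text \<open>The real-valued infima and the limit above are well defined: the infima are over
  nonempty sets bounded below by \<open>0\<close>, and the limit is that of a bounded monotone sequence.\<close>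

lemma window_bdd_below:
  "bdd_below ((\<lambda>(M, N). real (card ({M..<N} \<inter> A)) / real (N - M)) ` S)"
  by (rule bdd_belowI[of _ 0]) auto

lemma window_nonempty: "{(M::nat, N). M < N \<and> N - M \<ge> L} \<noteq> {}"
proof -
  have "(0, Suc L) \<in> {(M::nat, N). M < N \<and> N - M \<ge> L}"
    by simp
  then show ?thesis
    by blast
qed

lemma incseq_window_inf: "incseq (window_inf A)"
  unfolding incseq_def window_inf_def
proof (intro allI impI)
  fix m n :: nat
  assume "m \<le> n"
  then show "(INF (M, N) \<in> {(M, N). M < N \<and> N - M \<ge> m}. real (card ({M..<N} \<inter> A)) / real (N - M))
    \<le> (INF (M, N) \<in> {(M, N). M < N \<and> N - M \<ge> n}. real (card ({M..<N} \<inter> A)) / real (N - M))"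
    by (intro cINF_superset_mono window_nonempty window_bdd_below) auto
qed

lemma window_inf_nonneg: "0 \<le> window_inf A L"
  unfolding window_inf_def
  by (rule cINF_greatest[OF window_nonempty]) auto

lemma window_inf_le_1: "window_inf A L \<le> 1"
proof -
  have "window_inf A L \<le> real (card ({0..<Suc L} \<inter> A)) / real (Suc L)"
    unfolding window_inf_def
    by (rule cINF_lower2[OF window_bdd_below, of "(0, Suc L)"]) auto
  also have "\<dots> \<le> 1"
    using card_mono[of "{0..<Suc L}" "{0..<Suc L} \<inter> A"] by (simp add: divide_simps)
  finally show ?thesis .
qed

lemma window_inf_tendsto: "window_inf A \<longlonglongrightarrow> banach_lower_density A"
proof -
  have "Bseq (window_inf A)"
    using window_inf_nonneg[of A] window_inf_le_1[of A] by (intro BseqI'[of _ 1]) auto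
  then have "convergent (window_inf A)"
    by (rule Bseq_mono_convergent) (use incseq_window_inf[of A] in \<open>auto simp: incseq_def\<close>)
  then show ?thesis
    unfolding banach_lower_density_def by (simp add: convergent_LIMSEQ_iff)
qed

lemma BD_lower_nonneg: "0 \<le> BD_lower f x E"
  unfolding BD_lower_def
  by (rule LIMSEQ_le_const[OF window_inf_tendsto]) (auto simp: window_inf_nonneg)

end

theory Submission
  imports Defs
begin

text \<open>
  Minimality together with compactness makes recurrence uniform. For a nonempty open set \<open>U\<close> the
  preimages of \<open>U\<close> under the iterates of \<open>f\<close> are open and cover \<open>X\<close>, so finitely many of them do:
  every orbit enters \<open>U\<close> within a number of steps that does not depend on the starting point
  (\<open>minimal_cascade_uniform_hitting_time\<close>).

  Given an entourage \<open>E\<close>, take a finite cover of \<open>X\<close> by open sets that are small of order \<open>E\<close>, and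
  let \<open>K\<close> exceed all their hitting times. Each \<open>x\<close> lies in some member \<open>U\<close> of the cover, and
  \<open>U \<subseteq> E[x]\<close>, so among any \<open>K\<close> consecutive points of the orbit of \<open>x\<close> one lies in
  \<open>E[x]\<close> (\<open>minimal_cascade_uniformly_syndetic\<close>). A set of times without a gap of length \<open>K\<close>
  has lower Banach density at least \<open>1 / (2 * K)\<close>
  (\<open>banach_lower_density_syndetic\<close>), and this bound is the same for all \<open>x\<close>.
\<close>

lemma card_syndetic_blocks:
  fixes A :: "nat set"
  assumes "\<And>m. \<exists>n\<in>A. m \<le> n \<and> n < m + K"
  shows "q \<le> card ({M..<M + q * K} \<inter> A)"
proof (induction q)
  case (Suc q)
  obtain n where n: "n \<in> A" "M + q * K \<le> n" "n < M + q * K + K"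
    using assms by blast
  have "insert n ({M..<M + q * K} \<inter> A) \<subseteq> {M..<M + Suc q * K} \<inter> A"
    using n by auto
  then have "card (insert n ({M..<M + q * K} \<inter> A)) \<le> card ({M..<M + Suc q * K} \<inter> A)"
    by (intro card_mono) auto
  moreover have "card (insert n ({M..<M + q * K} \<inter> A)) = Suc (card ({M..<M + q * K} \<inter> A))"
    using n by (subst card_insert_disjoint) auto
  ultimately show ?case
    using Suc.IH by linarith
qed simp

text \<open>A window of length \<open>l\<close> contains \<open>l div K\<close> disjoint blocks of length \<open>K\<close>, each of which meets
  the set. Rounding down costs at most a factor 2 once \<open>K \<le> l\<close>; this keeps the bound
  independent of \<open>l\<close>.\<close>

lemma banach_lower_density_syndetic:
  assumes K: "0 < K" and syndetic: "\<And>m. \<exists>n\<in>A. m \<le> n \<and> n < m + K"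
  shows "1 / (2 * real K) \<le> banach_lower_density A"
proof (rule LIMSEQ_le_const[OF window_inf_tendsto], intro exI allI impI)
  fix L assume L: "K \<le> L"
  show "1 / (2 * real K) \<le> window_inf A L"
    unfolding window_inf_def
  proof (rule cINF_greatest[OF window_nonempty], clarify)
    fix M N :: nat
    assume MN: "M < N" "L \<le> N - M"
    define q where "q = (N - M) div K"
    have q1: "1 \<le> q"
      unfolding q_def using K L MN by (simp add: div_greater_zero_iff Suc_le_eq)
    have rem: "N - M < q * K + K"
      unfolding q_def using K by (metis add.commute dividend_less_times_div mult.commute)
    have "K \<le> q * K"
      using q1 by simp
    with rem have "N - M \<le> q * (2 * K)"
      by linarith
    then have bound: "real (N - M) \<le> real q * (2 * real K)"
      by (metis of_nat_le_iff of_nat_mult of_nat_numeral)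
    have "M + q * K \<le> N"
      unfolding q_def using MN div_times_less_eq_dividend[of "N - M" K] by linarith
    then have "card ({M..<M + q * K} \<inter> A) \<le> card ({M..<N} \<inter> A)"
      by (intro card_mono) auto
    with card_syndetic_blocks[OF syndetic] have "q \<le> card ({M..<N} \<inter> A)"
      using le_trans by blast
    then have "real q * (2 * real K) \<le> real (card ({M..<N} \<inter> A)) * (2 * real K)"
      by (intro mult_right_mono) auto
    with bound have "real (N - M) \<le> real (card ({M..<N} \<inter> A)) * (2 * real K)"
      by linarith
    moreover have "0 < real (N - M)"
      using MN by simp
    ultimately show "1 / (2 * real K) \<le> real (card ({M..<N} \<inter> A)) / real (N - M)"
      using K by (simp add: pos_le_divide_eq pos_divide_le_eq del: of_nat_diff)
  qed
qed

lemma minimal_cascade_orbit_meets_open: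
  assumes "minimal_cascade f" "open U" "U \<noteq> {}"
  shows "\<exists>n. (f ^^ n) x \<in> U"
proof -
  have "U \<inter> closure {(f ^^ n) x | n. True} \<noteq> {}"
    using assms by (simp add: minimal_cascade_def)
  then show ?thesis
    using open_Int_closure_eq_empty[OF \<open>open U\<close>] by blast
qed

text \<open>Every point enters \<open>U\<close> at some time, and the points that do so at time \<open>n\<close> form an open set;
  by compactness finitely many of these times suffice.\<close>

lemma minimal_cascade_uniform_hitting_time:
  fixes f :: "'a::topological_space \<Rightarrow> 'a"
  assumes "compact (UNIV :: 'a set)" and cont: "continuous_on UNIV f"
    and "minimal_cascade f" "open U" "U \<noteq> {}"
  obtains K where "\<And>x. \<exists>n<K. (f ^^ n) x \<in> U"
proof -
  have cont_iter: "continuous_on UNIV (f ^^ n)" for n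
    by (induction n) (auto intro: continuous_on_compose2[OF cont])
  have "open ((f ^^ n) -` U)" for n
    using cont_iter \<open>open U\<close> by (rule open_vimage[rotated])
  moreover have "UNIV \<subseteq> (\<Union>n. (f ^^ n) -` U)"
    using minimal_cascade_orbit_meets_open[OF assms(3-5)] by auto
  ultimately obtain T where T: "finite T" "UNIV \<subseteq> (\<Union>n\<in>T. (f ^^ n) -` U)"
    using compactE_image[OF assms(1), of UNIV "\<lambda>n. (f ^^ n) -` U"] by auto
  from \<open>finite T\<close> obtain K where "\<forall>n\<in>T. n < K"
    using finite_nat_set_iff_bounded by auto
  with T(2) have "\<exists>n<K. (f ^^ n) x \<in> U" for x
    by blast
  then show thesis ..
qed

lemma small_open_neighbourhood:
  fixes x :: "'a::uniform_space"
  assumes "eventually (\<lambda>p. p \<in> E) uniformity"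
  obtains U where "open U" "x \<in> U" "U \<times> U \<subseteq> E"
proof -
  obtain D where D: "eventually D uniformity"
    and trans: "\<And>x y z. D (x, y) \<Longrightarrow> D (y, z) \<Longrightarrow> (x, z) \<in> E"
    using uniformity_transE[OF assms] by blast
  have "eventually (\<lambda>(a, b). D (a, b) \<and> D (b, a)) uniformity"
    using eventually_conj[OF D uniformity_sym[OF D]] by (simp add: case_prod_unfold)
  then have "eventually (\<lambda>y. D (x, y) \<and> D (y, x)) (nhds x)"
    unfolding eventually_nhds_uniformity by (rule eventually_mono) auto
  then obtain U where "open U" "x \<in> U" "\<forall>y\<in>U. D (x, y) \<and> D (y, x)"
    unfolding eventually_nhds by blast
  with trans show thesis
    by (intro that[of U]) auto
qed

text \<open>A single \<open>K\<close> serves all \<open>x\<close> because \<open>E[x]\<close> contains one of finitely many open sets. The hitting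
  time is applied to the orbit points \<open>f\<^sup>m x\<close>, while the target set is chosen from \<open>x\<close> alone.\<close>

lemma minimal_cascade_uniformly_syndetic:
  fixes f :: "'a::uniform_space \<Rightarrow> 'a"
  assumes compact: "compact (UNIV :: 'a set)" and "continuous_on UNIV f" "minimal_cascade f"
    and E: "eventually (\<lambda>p. p \<in> E) uniformity"
  obtains K where "0 < K"
    and "\<And>x m. \<exists>n\<in>return_times f x (E `` {x}). m \<le> n \<and> n < m + K"
proof -
  have "\<exists>U. open U \<and> x \<in> U \<and> U \<times> U \<subseteq> E" for x
    using small_open_neighbourhood[OF E] by metis
  then obtain U where U: "\<And>x. open (U x)" "\<And>x. x \<in> U x" "\<And>x. U x \<times> U x \<subseteq> E"
    by metis
  have "UNIV \<subseteq> (\<Union>y. U y)"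
    using U(2) by auto
  then obtain F where F: "finite F" "UNIV \<subseteq> (\<Union>y\<in>F. U y)"
    using compactE_image[OF compact, of UNIV U] U(1) by auto
  have "\<exists>K. \<forall>x. \<exists>n<K. (f ^^ n) x \<in> U y" for y
    using minimal_cascade_uniform_hitting_time[OF assms(1-3) U(1)] U(2) by (metis empty_iff)
  then obtain k where k: "\<And>y x. \<exists>n<k y. (f ^^ n) x \<in> U y"
    by metis
  define K where "K = Suc (\<Sum>y\<in>F. k y)"
  have "\<exists>n\<in>return_times f x (E `` {x}). m \<le> n \<and> n < m + K" for x m
  proof -
    obtain y where y: "y \<in> F" "x \<in> U y"
      using F(2) by blast
    obtain n where n: "n < k y" "(f ^^ n) ((f ^^ m) x) \<in> U y"
      using k by blast
    have "k y \<le> (\<Sum>y\<in>F. k y)"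
      using F(1) y(1) by (intro member_le_sum) auto
    with n(1) have "n + m < m + K"
      by (simp add: K_def)
    moreover have "(f ^^ (n + m)) x \<in> U y"
      using n(2) by (simp add: funpow_add)
    then have "n + m \<in> return_times f x (E `` {x})"
      using U(3)[of y] y(2) by (auto simp: return_times_def)
    ultimately show ?thesis
      by (intro bexI[of _ "n + m"]) auto
  qed
  then show thesis
    by (intro that[of K]) (auto simp: K_def)
qed

theorem theorem3p1:
  fixes f :: "'a::{uniform_space, t2_space} \<Rightarrow> 'a"
  assumes "compact (UNIV :: 'a set)"
    and "continuous_on UNIV f"
    and "minimal_cascade f"
  shows "\<forall>E \<in> (entourages :: ('a \<times> 'a) set set). (INF x. BD_lower f x E) > 0"
proof
  fix E :: "('a \<times> 'a) set"
  assume "E \<in> entourages"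
  then have "eventually (\<lambda>p. p \<in> E) uniformity"
    by (simp add: entourages_def)
  then obtain K where K: "0 < K"
    and syndetic: "\<And>x m. \<exists>n\<in>return_times f x (E `` {x}). m \<le> n \<and> n < m + K"
    using minimal_cascade_uniformly_syndetic[OF assms] by blast
  have "1 / (2 * real K) \<le> BD_lower f x E" for x
    unfolding BD_lower_def using K syndetic by (rule banach_lower_density_syndetic)
  then have "1 / (2 * real K) \<le> (INF x. BD_lower f x E)"
    by (intro cINF_greatest) auto
  moreover have "0 < 1 / (2 * real K)"
    using K by simp
  ultimately show "(INF x. BD_lower f x E) > 0"
    by linarith
qed

end
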